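(* Let $\mathscr G$ be an ample groupoid and let $\mathcal O$ be a $\mathscr G$-sheaf of indecomposable commutative rings (i.e. each stalk $\mathcal O_x$ is an indecomposable commutative ring). Then $\Gamma_c(\mathscr G^{(0)},\mathcal O)$ is von Neumann regular if and only if $\mathcal O_x$ is a field for all $x\in\mathscr G^{(0)}$.
   Context: "Compact" includes Hausdorff. A groupoid $\mathscr G$ (identified with its set of arrows) has unit space $\mathscr G^{(0)}$, $\boldsymbol d(\gamma)=\gamma^{-1}\gamma$, $\boldsymbol r(\gamma)=\gamma\gamma^{-1}$. It is ample if it is a topological groupoid such that $\mathscr G^{(0)}$ is locally compact Hausdorff with a basis of compact open sets and $\boldsymbol r$ is a local homeomorphism. A $\mathscr G$-sheaf $(E,p,\alpha)$ is a space $E$, a local homeomorphism $p:E\to\mathscr G^{(0)}$ and a continuous map $\alpha:\mathscr G\times_{\boldsymbol d,p}E\to E$, $(\gamma,e)\mapsto\alpha_\gamma(e)$, with $\alpha_{p(e)}(e)=e$, $p(\alpha_\gamma(e))=\boldsymbol r(\gamma)$, and $\alpha_\beta(\alpha_\gamma(e))=\alpha_{\beta\gamma}(e)$ whenever defined. The stalk at $x$ is $p^{-1}(x)$. A $\mathscr G$-sheaf of rings $\mathcal O=(E,p,\alpha)$ is a $\mathscr G$-sheaf with a unital ring structure on each stalk $\mathcal O_x$ such that fiberwise addition and multiplication $E\times_{p,p}E\to E$ and the unit section $x\mapsto 1_x$ are continuous, and each $\alpha_\gamma:\mathcal O_{\boldsymbol d(\gamma)}\to\mathcal O_{\boldsymbol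 r(\gamma)}$ is a (unital) ring homomorphism. $\Gamma_c(\mathscr G^{(0)},\mathcal O)$ is the ring of continuous sections $s:\mathscr G^{(0)}\to E$ of $p$ with compact support (i.e. $\{x: s(x)\neq 0_x\}$ is compact), with pointwise operations. A unital ring is indecomposable if $1\neq 0$ and it has no central idempotents other than $0$ and $1$. A (not necessarily unital) ring $R$ is von Neumann regular if $a\in aRa$ for all $a\in R$. *)

theory Defs
  imports "HOL-Analysis.Analysis" "HOL-Algebra.Ring"
begin

definition local_homeomorphism_map :: "'a topology \<Rightarrow> 'b topology \<Rightarrow> ('a \<Rightarrow> 'b) \<Rightarrow> bool" where
  "local_homeomorphism_map X Y f \<longleftrightarrow>
     (\<forall>x\<in>topspace X. \<exists>U. openin X U \<and> x \<in> U \<and> openin Y (f ` U) \<and>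
        homeomorphic_map (subtopology X U) (subtopology Y (f ` U)) f)"

definition has_compact_open_basis :: "'a topology \<Rightarrow> bool" where
  "has_compact_open_basis X \<longleftrightarrow>
     openin X = arbitrary union_of (\<lambda>U. openin X U \<and> compactin X U)"

text \<open>
  A groupoid is identified with its set of arrows, which is the underlying set of the topology
  \<open>arrow_top\<close>. The product \<open>gcomp \<G> \<beta> \<gamma>\<close> is only meaningful for composable pairs. The axioms of
  the algebraic part are the usual ones for a partial product with inverses; that \<open>\<beta>\<gamma>\<close> is defined
  exactly if \<open>d(\<beta>) = r(\<gamma>)\<close> is the consequence \<open>composable_iff\<close> below.
\<close>

record 'g groupoid =
  arrow_top :: "'g topology"
  composable :: "('g \<times> 'g) set"
  gcomp :: "'g \<Rightarrow> 'g \<Rightarrow> 'g"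
  ginv :: "'g \<Rightarrow> 'g"

abbreviation arrows :: "('g, 'm) groupoid_scheme \<Rightarrow> 'g set" where
  "arrows \<G> \<equiv> topspace (arrow_top \<G>)"

definition dom_map :: "('g, 'm) groupoid_scheme \<Rightarrow> 'g \<Rightarrow> 'g" where
  "dom_map \<G> \<gamma> = gcomp \<G> (ginv \<G> \<gamma>) \<gamma>"

definition ran_map :: "('g, 'm) groupoid_scheme \<Rightarrow> 'g \<Rightarrow> 'g" where
  "ran_map \<G> \<gamma> = gcomp \<G> \<gamma> (ginv \<G> \<gamma>)"

definition unit_space :: "('g, 'm) groupoid_scheme \<Rightarrow> 'g set" where
  "unit_space \<G> = dom_map \<G> ` arrows \<G>"

definition unit_top :: "('g, 'm) groupoid_scheme \<Rightarrow> 'g topology" where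
  "unit_top \<G> = subtopology (arrow_top \<G>) (unit_space \<G>)"

locale groupoid =
  fixes \<G> :: "('g, 'm) groupoid_scheme" (structure)
  assumes composable_subset: "composable \<G> \<subseteq> arrows \<G> \<times> arrows \<G>"
    and gcomp_closed: "(\<beta>, \<gamma>) \<in> composable \<G> \<Longrightarrow> gcomp \<G> \<beta> \<gamma> \<in> arrows \<G>"
    and ginv_closed: "\<gamma> \<in> arrows \<G> \<Longrightarrow> ginv \<G> \<gamma> \<in> arrows \<G>"
    and composable_left:
      "(\<beta>, \<gamma>) \<in> composable \<G> \<Longrightarrow> (\<gamma>, \<delta>) \<in> composable \<G> \<Longrightarrow> (gcomp \<G> \<beta> \<gamma>, \<delta>) \<in> composable \<G>"
    and composable_right:
      "(\<beta>, \<gamma>) \<in> composable \<G> \<Longrightarrow> (\<gamma>, \<delta>) \<in> composable \<G> \<Longrightarrow> (\<beta>, gcomp \<G> \<gamma> \<delta>) \<in> composable \<G>"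
    and gcomp_assoc:
      "(\<beta>, \<gamma>) \<in> composable \<G> \<Longrightarrow> (\<gamma>, \<delta>) \<in> composable \<G> \<Longrightarrow>
        gcomp \<G> (gcomp \<G> \<beta> \<gamma>) \<delta> = gcomp \<G> \<beta> (gcomp \<G> \<gamma> \<delta>)"
    and ginv_ginv: "\<gamma> \<in> arrows \<G> \<Longrightarrow> ginv \<G> (ginv \<G> \<gamma>) = \<gamma>"
    and composable_ginv: "\<gamma> \<in> arrows \<G> \<Longrightarrow> (\<gamma>, ginv \<G> \<gamma>) \<in> composable \<G>"
    and gcomp_cancel_left:
      "(\<beta>, \<gamma>) \<in> composable \<G> \<Longrightarrow> gcomp \<G> (ginv \<G> \<beta>) (gcomp \<G> \<beta> \<gamma>) = \<gamma>"
    and gcomp_cancel_right: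
      "(\<beta>, \<gamma>) \<in> composable \<G> \<Longrightarrow> gcomp \<G> (gcomp \<G> \<beta> \<gamma>) (ginv \<G> \<gamma>) = \<beta>"
begin

lemma composable_iff:
  "(\<beta>, \<gamma>) \<in> composable \<G> \<longleftrightarrow>
     \<beta> \<in> arrows \<G> \<and> \<gamma> \<in> arrows \<G> \<and> dom_map \<G> \<beta> = ran_map \<G> \<gamma>"
proof (intro iffI conjI)
  assume c: "(\<beta>, \<gamma>) \<in> composable \<G>"
  show b: "\<beta> \<in> arrows \<G>" and "\<gamma> \<in> arrows \<G>"
    using c composable_subset by auto
  have i: "(ginv \<G> \<beta>, \<beta>) \<in> composable \<G>"
    using b composable_ginv ginv_closed ginv_ginv by metis
  have "gcomp \<G> (gcomp \<G> (ginv \<G> \<beta>) \<beta>) \<gamma> = \<gamma>"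
    using i c gcomp_assoc gcomp_cancel_left by metis
  then show "dom_map \<G> \<beta> = ran_map \<G> \<gamma>"
    unfolding dom_map_def ran_map_def
    using gcomp_cancel_right[OF composable_left[OF i c]] by metis
next
  assume "\<beta> \<in> arrows \<G> \<and> \<gamma> \<in> arrows \<G> \<and> dom_map \<G> \<beta> = ran_map \<G> \<gamma>"
  then have b: "\<beta> \<in> arrows \<G>" and g: "\<gamma> \<in> arrows \<G>"
    and e: "gcomp \<G> (ginv \<G> \<beta>) \<beta> = gcomp \<G> \<gamma> (ginv \<G> \<gamma>)"
    by (auto simp: dom_map_def ran_map_def)
  have ib: "(ginv \<G> \<beta>, \<beta>) \<in> composable \<G>" and ig: "(ginv \<G> \<gamma>, \<gamma>) \<in> composable \<G>"
    using b g composable_ginv ginv_closed ginv_ginv by metis+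
  have 1: "(\<beta>, gcomp \<G> \<gamma> (ginv \<G> \<gamma>)) \<in> composable \<G>"
    using composable_right[OF composable_ginv[OF b] ib] e by simp
  have 2: "(gcomp \<G> \<gamma> (ginv \<G> \<gamma>), \<gamma>) \<in> composable \<G>"
    using composable_left[OF composable_ginv[OF g] ig] .
  have "gcomp \<G> (gcomp \<G> \<gamma> (ginv \<G> \<gamma>)) \<gamma> = \<gamma>"
    using gcomp_cancel_right[OF composable_ginv[OF g]] ginv_ginv[OF g] by simp
  then show "(\<beta>, \<gamma>) \<in> composable \<G>"
    using composable_right[OF 1 2] by simp
qed

end

locale topological_groupoid = groupoid \<G> for \<G> :: "('g, 'm) groupoid_scheme" (structure) +
  assumes continuous_gcomp:
      "continuous_map (subtopology (prod_topology (arrow_top \<G>) (arrow_top \<G>)) (composable \<G>))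
         (arrow_top \<G>) (\<lambda>(\<beta>, \<gamma>). gcomp \<G> \<beta> \<gamma>)"
    and continuous_ginv: "continuous_map (arrow_top \<G>) (arrow_top \<G>) (ginv \<G>)"

locale ample_groupoid = topological_groupoid \<G> for \<G> :: "('g, 'm) groupoid_scheme" (structure) +
  assumes unit_Hausdorff: "Hausdorff_space (unit_top \<G>)"
    and unit_locally_compact: "locally_compact_space (unit_top \<G>)"
    and unit_compact_open_basis: "has_compact_open_basis (unit_top \<G>)"
    and ran_local_homeomorphism:
      "local_homeomorphism_map (arrow_top \<G>) (unit_top \<G>) (ran_map \<G>)"

record ('g, 'e) gsheaf =
  etale_top :: "'e topology"
  proj :: "'e \<Rightarrow> 'g"
  act :: "'g \<Rightarrow> 'e \<Rightarrow> 'e"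

locale gsheaf = groupoid \<G>
  for \<G> :: "('g, 'm) groupoid_scheme" (structure) +
  fixes \<O> :: "('g, 'e, 'n) gsheaf_scheme"
  assumes proj_local_homeomorphism:
      "local_homeomorphism_map (etale_top \<O>) (unit_top \<G>) (proj \<O>)"
    and continuous_act:
      "continuous_map
         (subtopology (prod_topology (arrow_top \<G>) (etale_top \<O>)) {(\<gamma>, e). dom_map \<G> \<gamma> = proj \<O> e})
         (etale_top \<O>) (\<lambda>(\<gamma>, e). act \<O> \<gamma> e)"
    and act_unit: "e \<in> topspace (etale_top \<O>) \<Longrightarrow> act \<O> (proj \<O> e) e = e"
    and proj_act:
      "\<gamma> \<in> arrows \<G> \<Longrightarrow> e \<in> topspace (etale_top \<O>) \<Longrightarrow> dom_map \<G> \<gamma> = proj \<O> e \<Longrightarrow>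
         proj \<O> (act \<O> \<gamma> e) = ran_map \<G> \<gamma>"
    and act_act:
      "(\<beta>, \<gamma>) \<in> composable \<G> \<Longrightarrow> e \<in> topspace (etale_top \<O>) \<Longrightarrow> dom_map \<G> \<gamma> = proj \<O> e \<Longrightarrow>
         act \<O> \<beta> (act \<O> \<gamma> e) = act \<O> (gcomp \<G> \<beta> \<gamma>) e"

record ('g, 'e) ring_gsheaf = "('g, 'e) gsheaf" +
  stalk :: "'g \<Rightarrow> 'e ring"

locale gsheaf_of_rings = gsheaf \<G> \<O>
  for \<G> :: "('g, 'm) groupoid_scheme" (structure) and \<O> :: "('g, 'e, 'n) ring_gsheaf_scheme" +
  assumes carrier_stalk:
      "x \<in> unit_space \<G> \<Longrightarrow> carrier (stalk \<O> x) = {e \<in> topspace (etale_top \<O>). proj \<O> e = x}"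
    and ring_stalk: "x \<in> unit_space \<G> \<Longrightarrow> ring (stalk \<O> x)"
    and continuous_add:
      "continuous_map
         (subtopology (prod_topology (etale_top \<O>) (etale_top \<O>)) {(a, b). proj \<O> a = proj \<O> b})
         (etale_top \<O>) (\<lambda>(a, b). a \<oplus>\<^bsub>stalk \<O> (proj \<O> a)\<^esub> b)"
    and continuous_mult:
      "continuous_map
         (subtopology (prod_topology (etale_top \<O>) (etale_top \<O>)) {(a, b). proj \<O> a = proj \<O> b})
         (etale_top \<O>) (\<lambda>(a, b). a \<otimes>\<^bsub>stalk \<O> (proj \<O> a)\<^esub> b)"
    and continuous_unit_section:
      "continuous_map (unit_top \<G>) (etale_top \<O>) (\<lambda>x. \<one>\<^bsub>stalk \<O> x\<^esub>)"
    and act_ring_hom: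
      "\<gamma> \<in> arrows \<G> \<Longrightarrow>
         act \<O> \<gamma> \<in> ring_hom (stalk \<O> (dom_map \<G> \<gamma>)) (stalk \<O> (ran_map \<G> \<gamma>))"

text \<open>
  Sections are extensional functions on the unit space, so that equality of sections is pointwise
  equality there. The ring \<open>\<Gamma>\<^sub>c\<close> need not be unital: the record field \<open>one\<close> is filled
  with the unit section, which lies in the carrier only if its support is compact.
\<close>

definition compact_sections ::
    "('g, 'm) groupoid_scheme \<Rightarrow> ('g, 'e, 'n) ring_gsheaf_scheme \<Rightarrow> ('g \<Rightarrow> 'e) ring" where
  "compact_sections \<G> \<O> =
     \<lparr>carrier = {s \<in> extensional (unit_space \<G>).
         continuous_map (unit_top \<G>) (etale_top \<O>) s \<and>
         (\<forall>x\<in>unit_space \<G>. proj \<O> (s x) = x) \<and>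
         compactin (unit_top \<G>) {x \<in> unit_space \<G>. s x \<noteq> \<zero>\<^bsub>stalk \<O> x\<^esub>}},
      mult = (\<lambda>s t. \<lambda>x\<in>unit_space \<G>. s x \<otimes>\<^bsub>stalk \<O> x\<^esub> t x),
      one = (\<lambda>x\<in>unit_space \<G>. \<one>\<^bsub>stalk \<O> x\<^esub>),
      zero = (\<lambda>x\<in>unit_space \<G>. \<zero>\<^bsub>stalk \<O> x\<^esub>),
      add = (\<lambda>s t. \<lambda>x\<in>unit_space \<G>. s x \<oplus>\<^bsub>stalk \<O> x\<^esub> t x)\<rparr>"

locale indecomposable_ring = ring R for R (structure) +
  assumes one_neq_zero: "\<one> \<noteq> \<zero>"
    and central_idempotent:
      "e \<in> carrier R \<Longrightarrow> e \<otimes> e = e \<Longrightarrow> (\<And>a. a \<in> carrier R \<Longrightarrow> a \<otimes> e = e \<otimes> a) \<Longrightarrow>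
         e = \<zero> \<or> e = \<one>"

text \<open>The condition involves neither \<open>one\<close> nor any unitality, so it applies to non-unital rings.\<close>

definition von_neumann_regular :: "('a, 'm) ring_scheme \<Rightarrow> bool" where
  "von_neumann_regular R \<longleftrightarrow>
     (\<forall>a\<in>carrier R. a \<in> {a \<otimes>\<^bsub>R\<^esub> b \<otimes>\<^bsub>R\<^esub> a | b. b \<in> carrier R})"

end

theory Submission
  imports Defs
begin

text \<open>
  Two continuous sections of a local homeomorphism agree on an open set. If \<open>\<Gamma>\<^sub>c\<close> is regular,
  extend \<open>a \<in> \<O>\<^sub>x\<close> to a compactly supported section; evaluating \<open>s = s t s\<close> at \<open>x\<close> makes \<open>a\<close> regular
  in \<open>\<O>\<^sub>x\<close>, so \<open>a t(x)\<close> is an idempotent, hence \<open>0\<close> or \<open>1\<close>, and \<open>a\<close> is zero or invertible. Conversely,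
  if the stalks are fields, then the zero set of a section is clopen and the section that is the
  pointwise inverse off the zero set, and zero on it, is continuous with the same compact support.
\<close>

section \<open>Compact open bases, local homeomorphisms and local continuity\<close>

lemma has_compact_open_basisD:
  assumes "has_compact_open_basis X" and "openin X V" and "x \<in> V"
  obtains K where "openin X K" "compactin X K" "x \<in> K" "K \<subseteq> V"
proof -
  have "(arbitrary union_of (\<lambda>U. openin X U \<and> compactin X U)) V"
    using assms(1,2) unfolding has_compact_open_basis_def by metis
  then obtain \<U> where \<U>: "\<U> \<subseteq> Collect (\<lambda>U. openin X U \<and> compactin X U)" "\<Union>\<U> = V"
    unfolding union_of_def by blast
  then obtain K where "K \<in> \<U>" "x \<in> K"
    using assms(3) by auto
  then show ?thesis
    using that \<U> by blast
qed

text \<open>Local injectivity is what later forces two sections with a common value to coincide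
  nearby.\<close>

lemma local_homeomorphism_map_inj_nhd:
  assumes "local_homeomorphism_map X Y f" and "x \<in> topspace X"
  obtains U where "openin X U" "x \<in> U" "inj_on f U"
proof -
  obtain U where U: "openin X U" "x \<in> U"
    and h: "homeomorphic_map (subtopology X U) (subtopology Y (f ` U)) f"
    using assms unfolding local_homeomorphism_map_def by blast
  have "inj_on f U"
    using homeomorphic_imp_injective_map[OF h] openin_subset[OF U(1)]
    by (simp add: Int_absorb1)
  then show ?thesis
    using that U by blast
qed

text \<open>The inverse of the homeomorphism on a chart \<open>U\<close> around \<open>x\<close>;
  applied to the projection of a sheaf it becomes a local section through a prescribed
  point.\<close>

lemma local_homeomorphism_map_local_inverse:
  assumes "local_homeomorphism_map X Y f" and "x \<in> topspace X"
  obtains V g where "openin Y V" "f x \<in> V" "continuous_map (subtopology Y V) X g"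
    "\<And>y. y \<in> V \<Longrightarrow> f (g y) = y" "g (f x) = x"
proof -
  obtain U where U: "openin X U" "x \<in> U" "openin Y (f ` U)"
    and h: "homeomorphic_map (subtopology X U) (subtopology Y (f ` U)) f"
    using assms unfolding local_homeomorphism_map_def by blast
  obtain g where g: "homeomorphic_maps (subtopology X U) (subtopology Y (f ` U)) f g"
    using h homeomorphic_map_maps by blast
  have U': "topspace X \<inter> U = U" "topspace Y \<inter> f ` U = f ` U"
    using openin_subset U by blast+
  show ?thesis
  proof
    show "openin Y (f ` U)" "f x \<in> f ` U"
      using U by auto
    show "continuous_map (subtopology Y (f ` U)) X g"
      using g continuous_map_into_fulltopology unfolding homeomorphic_maps_def by blast
    show "f (g y) = y" if "y \<in> f ` U" for y
      using g that U' unfolding homeomorphic_maps_def by auto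
    show "g (f x) = x"
      using g U(2) U' unfolding homeomorphic_maps_def by auto
  qed
qed

lemma continuous_map_local_openin:
  assumes "\<And>x. x \<in> topspace X \<Longrightarrow> \<exists>W. openin X W \<and> x \<in> W \<and> continuous_map (subtopology X W) Y f"
  shows "continuous_map X Y f"
proof -
  have "\<forall>x\<in>topspace X. \<exists>W. openin X W \<and> x \<in> W \<and> continuous_map (subtopology X W) Y f"
    using assms by blast
  then obtain W where W: "\<forall>x\<in>topspace X. openin X (W x) \<and> x \<in> W x \<and> continuous_map (subtopology X (W x)) Y f"
    by metis
  show ?thesis
  \<comment> \<open>The pieces are indexed by points and all carry the same \<open>f\<close>, so
    agreement on overlaps is trivial.\<close>
  proof (rule pasting_lemma[where I = "topspace X" and T = W and f = "\<lambda>_. f"])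
    show "\<exists>j. j \<in> topspace X \<and> x \<in> W j \<and> f x = f x" if "x \<in> topspace X" for x
      using W that by blast
  qed (use W in auto)
qed

section \<open>Regular indecomposable commutative rings\<close>

lemma indecomposable_cring_fieldI:
  assumes "cring R" and "indecomposable_ring R"
    and "\<And>a. a \<in> carrier R \<Longrightarrow> \<exists>b\<in>carrier R. a = a \<otimes>\<^bsub>R\<^esub> b \<otimes>\<^bsub>R\<^esub> a"
  shows "field R"
proof -
  interpret cring R by fact
  interpret indecomposable_ring R by fact
  have "\<exists>b\<in>carrier R. a \<otimes>\<^bsub>R\<^esub> b = \<one>\<^bsub>R\<^esub>"
    if a: "a \<in> carrier R" and "a \<noteq> \<zero>\<^bsub>R\<^esub>" for a
  proof -
    obtain b where b: "b \<in> carrier R" and aba: "a = a \<otimes>\<^bsub>R\<^esub> b \<otimes>\<^bsub>R\<^esub> a"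
      using assms(3) a by blast
    have ab: "a \<otimes>\<^bsub>R\<^esub> b \<in> carrier R"
      using a b by simp
    \<comment> \<open>Reassociate to \<open>(a b a) b\<close> and use \<open>a b a = a\<close>.
      Commutativity then makes this idempotent central.\<close>
    have "(a \<otimes>\<^bsub>R\<^esub> b) \<otimes>\<^bsub>R\<^esub> (a \<otimes>\<^bsub>R\<^esub> b) = a \<otimes>\<^bsub>R\<^esub> b"
      using m_assoc[OF ab a b] aba by simp
    then have "a \<otimes>\<^bsub>R\<^esub> b = \<zero>\<^bsub>R\<^esub> \<or> a \<otimes>\<^bsub>R\<^esub> b = \<one>\<^bsub>R\<^esub>"
      using central_idempotent[OF ab] m_comm ab by blast
    moreover have "a \<otimes>\<^bsub>R\<^esub> b \<noteq> \<zero>\<^bsub>R\<^esub>"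
    proof
      assume "a \<otimes>\<^bsub>R\<^esub> b = \<zero>\<^bsub>R\<^esub>"
      then show False
        using aba l_null[OF a] \<open>a \<noteq> \<zero>\<^bsub>R\<^esub>\<close> by argo
    qed
    ultimately show ?thesis
      using b by blast
  qed
  then show ?thesis
    using one_neq_zero by (intro cring_fieldI2) auto
qed

section \<open>The unit space and local sections of the sheaf\<close>

context groupoid
begin

text \<open>Units are themselves arrows, so passing to the subspace loses no point of
  \<open>unit_space\<close>.\<close>

lemma topspace_unit_top: "topspace (unit_top \<G>) = unit_space \<G>"
proof -
  have "dom_map \<G> \<gamma> \<in> arrows \<G>" if "\<gamma> \<in> arrows \<G>" for \<gamma>
    using that composable_ginv gcomp_closed ginv_closed ginv_ginv unfolding dom_map_def by metis
  then show ?thesis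
    unfolding unit_top_def unit_space_def by auto
qed

end

context gsheaf_of_rings
begin

text \<open>The section is a total function with arbitrary values off \<open>V\<close>, so the same
  function can be restricted to smaller sets and glued without changing it.\<close>

definition section_on :: "'g set \<Rightarrow> ('g \<Rightarrow> 'e) \<Rightarrow> bool" where
  "section_on V s \<longleftrightarrow>
     continuous_map (subtopology (unit_top \<G>) V) (etale_top \<O>) s \<and> (\<forall>x\<in>V. proj \<O> (s x) = x)"

lemma openin_unit_subset: "openin (unit_top \<G>) V \<Longrightarrow> V \<subseteq> unit_space \<G>"
  using openin_subset topspace_unit_top by metis

lemma section_on_in_stalk:
  assumes "section_on V s" and "x \<in> V" and "x \<in> unit_space \<G>"
  shows "s x \<in> carrier (stalk \<O> x)"
proof -
  have "x \<in> topspace (subtopology (unit_top \<G>) V)"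
    using assms topspace_unit_top by auto
  then have "s x \<in> topspace (etale_top \<O>)"
    using assms(1) continuous_map_image_subset_topspace unfolding section_on_def by blast
  then show ?thesis
    using assms carrier_stalk unfolding section_on_def by simp
qed

lemma section_on_subset: "section_on V s \<Longrightarrow> W \<subseteq> V \<Longrightarrow> section_on W s"
  unfolding section_on_def using continuous_map_from_subtopology_mono by blast

lemma section_on_cong:
  assumes "section_on V s" and "\<And>x. x \<in> V \<Longrightarrow> s x = t x"
  shows "section_on V t"
  using assms continuous_map_eq[of "subtopology (unit_top \<G>) V" "etale_top \<O>" s t]
  unfolding section_on_def by auto

text \<open>Being a section is a local property. This is the tool for sections defined by cases on
  open pieces.\<close>

lemma section_on_local:
  assumes "\<And>x. x \<in> V \<Longrightarrow> \<exists>W. openin (unit_top \<G>) W \<and> x \<in> W \<and> section_on W s"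
  shows "section_on V s"
proof -
  have "continuous_map (subtopology (unit_top \<G>) V) (etale_top \<O>) s"
  proof (rule continuous_map_local_openin)
    fix x assume x: "x \<in> topspace (subtopology (unit_top \<G>) V)"
    then obtain W where W: "openin (unit_top \<G>) W" "x \<in> W" "section_on W s"
      using assms by auto
    \<comment> \<open>\<open>V\<close> may fail to be open, so the neighbourhood is cut down to
      \<open>V \<inter> W\<close>, which is open relative to \<open>V\<close>.\<close>
    have "continuous_map (subtopology (subtopology (unit_top \<G>) V) (V \<inter> W)) (etale_top \<O>) s"
      using section_on_subset[OF W(3), of "V \<inter> W"]
      unfolding section_on_def by (simp add: subtopology_subtopology)
    moreover have "openin (subtopology (unit_top \<G>) V) (V \<inter> W)"
      using W(1) openin_subtopology_Int2 by blast
    ultimately show "\<exists>W. openin (subtopology (unit_top \<G>) V) W \<and> x \<in> W \<and>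
        continuous_map (subtopology (subtopology (unit_top \<G>) V) W) (etale_top \<O>) s"
      using W(2) x by auto
  qed
  then show ?thesis
    using assms unfolding section_on_def by blast
qed

lemma section_on_unit_space:
  "section_on (unit_space \<G>) s \<longleftrightarrow>
     continuous_map (unit_top \<G>) (etale_top \<O>) s \<and> (\<forall>x\<in>unit_space \<G>. proj \<O> (s x) = x)"
  using subtopology_topspace[of "unit_top \<G>"] unfolding section_on_def topspace_unit_top by simp

text \<open>Near a point of agreement both sections take values in one open set on which the
  projection is injective, and their values over the same point have the same projection.\<close>

lemma openin_section_eq:
  assumes V: "openin (unit_top \<G>) V" and s: "section_on V s" and t: "section_on V t"
  shows "openin (unit_top \<G>) {x \<in> V. s x = t x}"
proof (subst openin_subopen, intro ballI)
  fix x assume "x \<in> {x \<in> V. s x = t x}"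
  then have x: "x \<in> V" "s x = t x" by auto
  have xs: "s x \<in> topspace (etale_top \<O>)"
    using section_on_in_stalk[OF s x(1)] carrier_stalk openin_unit_subset[OF V] x(1) by auto
  obtain U where U: "openin (etale_top \<O>) U" "s x \<in> U" "inj_on (proj \<O>) U"
    using local_homeomorphism_map_inj_nhd[OF proj_local_homeomorphism xs] .
  let ?W = "{y \<in> V. s y \<in> U} \<inter> {y \<in> V. t y \<in> U}"
  have top: "topspace (subtopology (unit_top \<G>) V) = V"
    using openin_subset[OF V] by auto
  have "openin (subtopology (unit_top \<G>) V) {y \<in> V. s y \<in> U}"
    "openin (subtopology (unit_top \<G>) V) {y \<in> V. t y \<in> U}"
    using s t U(1) openin_continuous_map_preimage top unfolding section_on_def by fastforce+
  then have "openin (unit_top \<G>) ?W"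
    using V openin_open_subtopology by blast
  moreover have "?W \<subseteq> {x \<in> V. s x = t x}"
  proof
    fix y assume y: "y \<in> ?W"
    then have "proj \<O> (s y) = proj \<O> (t y)"
      using s t unfolding section_on_def by auto
    then show "y \<in> {x \<in> V. s x = t x}"
      using U(3) y unfolding inj_on_def by auto
  qed
  ultimately show "\<exists>T. openin (unit_top \<G>) T \<and> x \<in> T \<and> T \<subseteq> {x \<in> V. s x = t x}"
    using x U(2) by auto
qed

lemma section_through:
  assumes "x \<in> unit_space \<G>" and "e \<in> carrier (stalk \<O> x)"
  obtains V s where "openin (unit_top \<G>) V" "x \<in> V" "section_on V s" "s x = e"
proof -
  have e: "e \<in> topspace (etale_top \<O>)" "proj \<O> e = x"
    using assms carrier_stalk by auto
  show ?thesis
  proof (rule local_homeomorphism_map_local_inverse[OF proj_local_homeomorphism e(1)])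
    fix V s assume "openin (unit_top \<G>) V" "proj \<O> e \<in> V"
      "continuous_map (subtopology (unit_top \<G>) V) (etale_top \<O>) s"
      "\<And>y. y \<in> V \<Longrightarrow> proj \<O> (s y) = y" "s (proj \<O> e) = e"
    then show ?thesis
      using that e(2) unfolding section_on_def by blast
  qed
qed

text \<open>Pairing two sections gives a continuous map into the fibre product. The operation
  \<open>f\<close> carries the base point as an index because the ring structure varies with the
  stalk; along a section that index \<open>proj \<O> (s x)\<close> is just \<open>x\<close>.\<close>

lemma section_on_binop:
  assumes op: "continuous_map
         (subtopology (prod_topology (etale_top \<O>) (etale_top \<O>)) {(a, b). proj \<O> a = proj \<O> b})
         (etale_top \<O>) (\<lambda>(a, b). f (proj \<O> a) a b)"
    and closed: "\<And>x a b. x \<in> unit_space \<G> \<Longrightarrow> a \<in> carrier (stalk \<O> x) \<Longrightarrow> b \<in> carrier (stalk \<O> x) \<Longrightarrow>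
      f x a b \<in> carrier (stalk \<O> x)"
    and V: "openin (unit_top \<G>) V" and s: "section_on V s" and t: "section_on V t"
  shows "section_on V (\<lambda>x. f x (s x) (t x))"
proof -
  have top: "topspace (subtopology (unit_top \<G>) V) = V"
    using openin_subset[OF V] by auto
  have "continuous_map (subtopology (unit_top \<G>) V)
         (subtopology (prod_topology (etale_top \<O>) (etale_top \<O>)) {(a, b). proj \<O> a = proj \<O> b})
         (\<lambda>x. (s x, t x))"
    using s t unfolding section_on_def
    by (auto intro!: continuous_map_into_subtopology simp: top continuous_map_pairedI)
  from continuous_map_compose[OF this op]
  have "continuous_map (subtopology (unit_top \<G>) V) (etale_top \<O>) (\<lambda>x. f (proj \<O> (s x)) (s x) (t x))"
    by (simp add: o_def)
  then have "continuous_map (subtopology (unit_top \<G>) V) (etale_top \<O>) (\<lambda>x. f x (s x) (t x))"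
    by (rule continuous_map_eq) (use s top in \<open>auto simp: section_on_def\<close>)
  moreover have "proj \<O> (f x (s x) (t x)) = x" if "x \<in> V" for x
  proof -
    have "x \<in> unit_space \<G>"
      using that openin_unit_subset[OF V] by auto
    with closed[OF this section_on_in_stalk[OF s that this] section_on_in_stalk[OF t that this]]
    show ?thesis
      using carrier_stalk by auto
  qed
  ultimately show ?thesis
    unfolding section_on_def by simp
qed

lemma section_on_add:
  assumes "openin (unit_top \<G>) V" and "section_on V s" and "section_on V t"
  shows "section_on V (\<lambda>x. s x \<oplus>\<^bsub>stalk \<O> x\<^esub> t x)"
  by (rule section_on_binop[where f = "\<lambda>x. add (stalk \<O> x)", OF continuous_add _ assms])
    (erule ring.ring_simprules(1)[OF ring_stalk])

lemma section_on_mult: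
  assumes "openin (unit_top \<G>) V" and "section_on V s" and "section_on V t"
  shows "section_on V (\<lambda>x. s x \<otimes>\<^bsub>stalk \<O> x\<^esub> t x)"
  by (rule section_on_binop[where f = "\<lambda>x. mult (stalk \<O> x)", OF continuous_mult _ assms])
    (erule ring.ring_simprules(5)[OF ring_stalk])

lemma section_on_one: "section_on (unit_space \<G>) (\<lambda>x. \<one>\<^bsub>stalk \<O> x\<^esub>)"
  unfolding section_on_unit_space
proof (intro conjI ballI)
  fix x assume x: "x \<in> unit_space \<G>"
  interpret ring "stalk \<O> x" using ring_stalk[OF x] .
  show "proj \<O> \<one>\<^bsub>stalk \<O> x\<^esub> = x"
    using carrier_stalk[OF x] one_closed by simp
qed (rule continuous_unit_section)

text \<open>The axioms do not require the zero section to be continuous. It is: a local section \<open>s\<close>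
  through \<open>0\<^sub>x\<close> agrees with \<open>s + s\<close> at \<open>x\<close>, hence near \<open>x\<close>, where it therefore vanishes.\<close>

lemma section_on_zero: "section_on (unit_space \<G>) (\<lambda>x. \<zero>\<^bsub>stalk \<O> x\<^esub>)"
proof (rule section_on_local)
  fix x assume x: "x \<in> unit_space \<G>"
  interpret ring "stalk \<O> x" using ring_stalk[OF x] .
  obtain V s where V: "openin (unit_top \<G>) V" "x \<in> V" and s: "section_on V s"
    and sx: "s x = \<zero>\<^bsub>stalk \<O> x\<^esub>"
    using section_through[OF x zero_closed] .
  let ?W = "{y \<in> V. s y \<oplus>\<^bsub>stalk \<O> y\<^esub> s y = s y}"
  have "openin (unit_top \<G>) ?W"
    by (rule openin_section_eq[OF V(1) section_on_add[OF V(1) s s] s])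
  moreover have "x \<in> ?W"
    using V(2) sx by simp
  moreover have "section_on ?W (\<lambda>x. \<zero>\<^bsub>stalk \<O> x\<^esub>)"
  proof (rule section_on_cong)
    show "section_on ?W s"
      by (rule section_on_subset[OF s]) auto
    fix y assume y: "y \<in> ?W"
    then have yu: "y \<in> unit_space \<G>"
      using openin_unit_subset[OF V(1)] by auto
    interpret y: ring "stalk \<O> y" using ring_stalk[OF yu] .
    have "s y \<in> carrier (stalk \<O> y)"
      using section_on_in_stalk[OF s] y yu by auto
    then show "s y = \<zero>\<^bsub>stalk \<O> y\<^esub>"
      using y y.add.l_cancel_one by auto
  qed
  ultimately show "\<exists>W. openin (unit_top \<G>) W \<and> x \<in> W \<and> section_on W (\<lambda>x. \<zero>\<^bsub>stalk \<O> x\<^esub>)"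
    by blast
qed

text \<open>The zero section is continuous, so vanishing is a case of agreement of two
  sections.\<close>

lemma openin_section_eq_zero:
  assumes "openin (unit_top \<G>) V" and "section_on V s"
  shows "openin (unit_top \<G>) {x \<in> V. s x = \<zero>\<^bsub>stalk \<O> x\<^esub>}"
  by (rule openin_section_eq[OF assms section_on_subset[OF section_on_zero openin_unit_subset[OF assms(1)]]])

section \<open>Compactly supported sections and regularity of the stalks\<close>

lemma section_in_compact_sections_iff:
  "s \<in> carrier (compact_sections \<G> \<O>) \<longleftrightarrow>
     s \<in> extensional (unit_space \<G>) \<and> section_on (unit_space \<G>) s \<and>
     compactin (unit_top \<G>) {x \<in> unit_space \<G>. s x \<noteq> \<zero>\<^bsub>stalk \<O> x\<^esub>}"
  unfolding compact_sections_def section_on_unit_space by auto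

text \<open>A local section through \<open>e\<close> is cut off outside a compact open neighbourhood
  \<open>K\<close> of \<open>x\<close>. Since \<open>K\<close> is clopen, extension by zero stays
  continuous.\<close>

lemma compact_section_through:
  assumes haus: "Hausdorff_space (unit_top \<G>)" and basis: "has_compact_open_basis (unit_top \<G>)"
    and x: "x \<in> unit_space \<G>" and e: "e \<in> carrier (stalk \<O> x)"
  obtains s where "s \<in> carrier (compact_sections \<G> \<O>)" "s x = e"
proof -
  obtain V s where V: "openin (unit_top \<G>) V" "x \<in> V" and s: "section_on V s" and sx: "s x = e"
    using section_through[OF x e] .
  obtain K where K: "openin (unit_top \<G>) K" "compactin (unit_top \<G>) K" "x \<in> K" "K \<subseteq> V"
    using has_compact_open_basisD[OF basis V] .
  define t where "t = (\<lambda>y\<in>unit_space \<G>. if y \<in> K then s y else \<zero>\<^bsub>stalk \<O> y\<^esub>)"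
  have Ku: "K \<subseteq> unit_space \<G>"
    using openin_unit_subset[OF K(1)] .
  \<comment> \<open>Here the Hausdorff property enters: the compact set \<open>K\<close> is
    closed.\<close>
  have co: "openin (unit_top \<G>) (unit_space \<G> - K)"
    using compactin_imp_closedin[OF haus K(2)] topspace_unit_top unfolding closedin_def by simp
  have tK: "section_on K t"
    by (rule section_on_cong[OF section_on_subset[OF s K(4)]]) (use Ku in \<open>auto simp: t_def\<close>)
  have tc: "section_on (unit_space \<G> - K) t"
    by (rule section_on_cong[OF section_on_subset[OF section_on_zero]]) (auto simp: t_def)
  have t: "section_on (unit_space \<G>) t"
  proof (rule section_on_local)
    fix y assume "y \<in> unit_space \<G>"
    then show "\<exists>W. openin (unit_top \<G>) W \<and> y \<in> W \<and> section_on W t"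
      using tK tc co K(1) by (cases "y \<in> K") auto
  qed
  have u: "openin (unit_top \<G>) (unit_space \<G>)"
    using topspace_unit_top openin_topspace by metis
  \<comment> \<open>The support can be smaller than \<open>K\<close>, as \<open>s\<close> may vanish
    inside \<open>K\<close>. It is compact because it is a closed subset of
    \<open>K\<close>.\<close>
  have "closedin (unit_top \<G>) {y \<in> unit_space \<G>. t y \<noteq> \<zero>\<^bsub>stalk \<O> y\<^esub>}"
  proof -
    have "unit_space \<G> - {y \<in> unit_space \<G>. t y \<noteq> \<zero>\<^bsub>stalk \<O> y\<^esub>} =
        {y \<in> unit_space \<G>. t y = \<zero>\<^bsub>stalk \<O> y\<^esub>}" by auto
    then show ?thesis
      using openin_section_eq_zero[OF u t] unfolding closedin_def topspace_unit_top by auto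
  qed
  moreover have "{y \<in> unit_space \<G>. t y \<noteq> \<zero>\<^bsub>stalk \<O> y\<^esub>} \<subseteq> K"
    by (auto simp: t_def)
  ultimately have "compactin (unit_top \<G>) {y \<in> unit_space \<G>. t y \<noteq> \<zero>\<^bsub>stalk \<O> y\<^esub>}"
    using closed_compactin[OF K(2)] by blast
  then have "t \<in> carrier (compact_sections \<G> \<O>)"
    unfolding section_in_compact_sections_iff using t by (auto simp: t_def)
  moreover have "t x = e"
    using K(3) x sx by (simp add: t_def)
  ultimately show ?thesis
    using that by blast
qed

lemma von_neumann_regular_stalk:
  assumes "Hausdorff_space (unit_top \<G>)" and "has_compact_open_basis (unit_top \<G>)"
    and reg: "von_neumann_regular (compact_sections \<G> \<O>)"
    and x: "x \<in> unit_space \<G>" and a: "a \<in> carrier (stalk \<O> x)"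
  shows "\<exists>b\<in>carrier (stalk \<O> x). a = a \<otimes>\<^bsub>stalk \<O> x\<^esub> b \<otimes>\<^bsub>stalk \<O> x\<^esub> a"
proof -
  obtain s where s: "s \<in> carrier (compact_sections \<G> \<O>)" "s x = a"
    using compact_section_through[OF assms(1,2) x a] .
  obtain t where t: "t \<in> carrier (compact_sections \<G> \<O>)"
    and st: "s = s \<otimes>\<^bsub>compact_sections \<G> \<O>\<^esub> t \<otimes>\<^bsub>compact_sections \<G> \<O>\<^esub> s"
    using reg s(1) unfolding von_neumann_regular_def by blast
  \<comment> \<open>Operations on sections are pointwise, so evaluation at \<open>x\<close> carries
    the relation into the stalk.\<close>
  have "a = a \<otimes>\<^bsub>stalk \<O> x\<^esub> t x \<otimes>\<^bsub>stalk \<O> x\<^esub> a"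
    using fun_cong[OF st, of x] s(2) x by (simp add: compact_sections_def)
  moreover have "t x \<in> carrier (stalk \<O> x)"
    using t section_on_in_stalk x unfolding section_in_compact_sections_iff by blast
  ultimately show ?thesis
    by blast
qed

section \<open>Pointwise inverses over field stalks\<close>

text \<open>A local section through \<open>s(x)\<^sup>-\<^sup>1\<close> inverts \<open>s\<close> at \<open>x\<close>, hence near \<open>x\<close>.\<close>

lemma section_on_inverse:
  assumes field: "\<And>y. y \<in> unit_space \<G> \<Longrightarrow> field (stalk \<O> y)"
    and V: "openin (unit_top \<G>) V" and s: "section_on V s"
    and x: "x \<in> V" and sx: "s x \<noteq> \<zero>\<^bsub>stalk \<O> x\<^esub>"
  obtains W where "openin (unit_top \<G>) W" "x \<in> W" "W \<subseteq> {y \<in> V. s y \<noteq> \<zero>\<^bsub>stalk \<O> y\<^esub>}"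
    "section_on W (\<lambda>y. inv\<^bsub>stalk \<O> y\<^esub> s y)"
proof -
  have xu: "x \<in> unit_space \<G>"
    using x openin_unit_subset[OF V] by auto
  interpret x: field "stalk \<O> x" using field[OF xu] .
  have "s x \<in> Units (stalk \<O> x)"
    using section_on_in_stalk[OF s x xu] sx x.field_Units by simp
  then have ix: "inv\<^bsub>stalk \<O> x\<^esub> s x \<in> carrier (stalk \<O> x)"
    "s x \<otimes>\<^bsub>stalk \<O> x\<^esub> inv\<^bsub>stalk \<O> x\<^esub> s x = \<one>\<^bsub>stalk \<O> x\<^esub>"
    by auto
  obtain V' t where V': "openin (unit_top \<G>) V'" "x \<in> V'" and t: "section_on V' t"
    and tx: "t x = inv\<^bsub>stalk \<O> x\<^esub> s x"
    using section_through[OF xu ix(1)] .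
  let ?I = "V \<inter> V'"
  have I: "openin (unit_top \<G>) ?I"
    using V V'(1) by auto
  have sI: "section_on ?I s" and tI: "section_on ?I t"
    using section_on_subset s t by auto
  let ?W = "{y \<in> ?I. s y \<otimes>\<^bsub>stalk \<O> y\<^esub> t y = \<one>\<^bsub>stalk \<O> y\<^esub>}"
  have W: "openin (unit_top \<G>) ?W"
    using openin_section_eq[OF I section_on_mult[OF I sI tI]
        section_on_subset[OF section_on_one openin_unit_subset[OF I]]] .
  \<comment> \<open>In the field over \<open>y\<close>, the equation \<open>s y\<close> times
    \<open>t y\<close> equals one excludes \<open>s y = 0\<close> and identifies \<open>t y\<close>
    with the inverse. Thus the pointwise inverse inherits its continuity on \<open>?W\<close> from
    \<open>t\<close>.\<close>
  have inverse: "s y \<noteq> \<zero>\<^bsub>stalk \<O> y\<^esub> \<and> t y = inv\<^bsub>stalk \<O> y\<^esub> s y" if y: "y \<in> ?W" for y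
  proof -
    have yu: "y \<in> unit_space \<G>"
      using y openin_unit_subset[OF V] by auto
    interpret y: field "stalk \<O> y" using field[OF yu] .
    have c: "s y \<in> carrier (stalk \<O> y)" "t y \<in> carrier (stalk \<O> y)"
      using section_on_in_stalk[OF sI _ yu] section_on_in_stalk[OF tI _ yu] y by auto
    then show ?thesis
      using y y.comm_inv_char[OF c] y.l_null[OF c(2)] y.one_not_zero by auto
  qed
  show ?thesis
  proof
    show "openin (unit_top \<G>) ?W" by fact
    show "x \<in> ?W"
      using x V' tx ix(2) by simp
    show "?W \<subseteq> {y \<in> V. s y \<noteq> \<zero>\<^bsub>stalk \<O> y\<^esub>}"
      using inverse by auto
    show "section_on ?W (\<lambda>y. inv\<^bsub>stalk \<O> y\<^esub> s y)"
    proof (rule section_on_cong)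
      show "section_on ?W t"
        by (rule section_on_subset[OF tI]) auto
    qed (use inverse in blast)
  qed
qed

lemma von_neumann_regular_compact_sections:
  assumes field: "\<And>y. y \<in> unit_space \<G> \<Longrightarrow> field (stalk \<O> y)"
  shows "von_neumann_regular (compact_sections \<G> \<O>)"
  unfolding von_neumann_regular_def
proof
  fix s assume "s \<in> carrier (compact_sections \<G> \<O>)"
  then have ext: "s \<in> extensional (unit_space \<G>)" and s: "section_on (unit_space \<G>) s"
    and comp: "compactin (unit_top \<G>) {x \<in> unit_space \<G>. s x \<noteq> \<zero>\<^bsub>stalk \<O> x\<^esub>}"
    unfolding section_in_compact_sections_iff by auto
  have u: "openin (unit_top \<G>) (unit_space \<G>)"
    using topspace_unit_top openin_topspace by metis
  \<comment> \<open>The value on the zero set is prescribed because \<open>inv\<close> of zero is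
    unspecified; choosing zero there keeps the support compact.\<close>
  define t where
    "t = (\<lambda>x\<in>unit_space \<G>. if s x = \<zero>\<^bsub>stalk \<O> x\<^esub> then \<zero>\<^bsub>stalk \<O> x\<^esub> else inv\<^bsub>stalk \<O> x\<^esub> s x)"
  \<comment> \<open>The first conjunct is regularity in each stalk; the second says that
    \<open>t\<close> and \<open>s\<close> have the same support, which transfers
    compactness.\<close>
  have cancel: "s x \<otimes>\<^bsub>stalk \<O> x\<^esub> t x \<otimes>\<^bsub>stalk \<O> x\<^esub> s x = s x \<and>
      (t x = \<zero>\<^bsub>stalk \<O> x\<^esub> \<longleftrightarrow> s x = \<zero>\<^bsub>stalk \<O> x\<^esub>)"
    if x: "x \<in> unit_space \<G>" for x
  proof -
    interpret field "stalk \<O> x" using field[OF x] .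
    have sx: "s x \<in> carrier (stalk \<O> x)"
      using section_on_in_stalk[OF s x x] .
    show ?thesis
    proof (cases "s x = \<zero>\<^bsub>stalk \<O> x\<^esub>")
      case True
      then show ?thesis using x by (simp add: t_def)
    next
      case False
      then have "s x \<in> Units (stalk \<O> x)"
        using sx field_Units by simp
      then have "s x \<otimes>\<^bsub>stalk \<O> x\<^esub> t x = \<one>\<^bsub>stalk \<O> x\<^esub>"
        using x False by (simp add: t_def)
      then show ?thesis
        using sx False r_null one_not_zero by auto
    qed
  qed
  have "section_on (unit_space \<G>) t"
  proof (rule section_on_local)
    fix x assume x: "x \<in> unit_space \<G>"
    show "\<exists>W. openin (unit_top \<G>) W \<and> x \<in> W \<and> section_on W t"
    \<comment> \<open>Each case supplies an open neighbourhood on which only one branch of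
      \<open>t\<close> is active: the zero set of \<open>s\<close>, or a set where \<open>s\<close>
      is invertible.\<close>
    proof (cases "s x = \<zero>\<^bsub>stalk \<O> x\<^esub>")
      case True
      let ?Z = "{x \<in> unit_space \<G>. s x = \<zero>\<^bsub>stalk \<O> x\<^esub>}"
      have "section_on ?Z t"
        by (rule section_on_cong[OF section_on_subset[OF section_on_zero]]) (auto simp: t_def)
      then show ?thesis
        using openin_section_eq_zero[OF u s] True x by blast
    next
      case False
      obtain W where W: "openin (unit_top \<G>) W" "x \<in> W"
        "W \<subseteq> {y \<in> unit_space \<G>. s y \<noteq> \<zero>\<^bsub>stalk \<O> y\<^esub>}" "section_on W (\<lambda>y. inv\<^bsub>stalk \<O> y\<^esub> s y)"
        using section_on_inverse[OF field u s x False] .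
      have "section_on W t"
        by (rule section_on_cong[OF W(4)]) (use W(3) in \<open>auto simp: t_def\<close>)
      then show ?thesis
        using W by blast
    qed
  qed
  moreover have "{x \<in> unit_space \<G>. t x \<noteq> \<zero>\<^bsub>stalk \<O> x\<^esub>} = {x \<in> unit_space \<G>. s x \<noteq> \<zero>\<^bsub>stalk \<O> x\<^esub>}"
    using cancel by blast
  ultimately have "t \<in> carrier (compact_sections \<G> \<O>)"
    unfolding section_in_compact_sections_iff using comp by (simp add: t_def)
  moreover have "s = s \<otimes>\<^bsub>compact_sections \<G> \<O>\<^esub> t \<otimes>\<^bsub>compact_sections \<G> \<O>\<^esub> s"
    \<comment> \<open>Both sides are extensional on the unit space, so the stalkwise identity
      suffices.\<close>
    by (rule extensionalityI[OF ext]) (simp_all add: compact_sections_def cancel)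
  ultimately show "s \<in> {s \<otimes>\<^bsub>compact_sections \<G> \<O>\<^esub> b \<otimes>\<^bsub>compact_sections \<G> \<O>\<^esub> s | b.
      b \<in> carrier (compact_sections \<G> \<O>)}"
    by blast
qed

end

theorem proposition4p7:
  fixes \<G> :: "'g groupoid" and \<O> :: "('g, 'e) ring_gsheaf"
  assumes "ample_groupoid \<G>"
    and "gsheaf_of_rings \<G> \<O>"
    and "\<And>x. x \<in> unit_space \<G> \<Longrightarrow> cring (stalk \<O> x)"
    and "\<And>x. x \<in> unit_space \<G> \<Longrightarrow> indecomposable_ring (stalk \<O> x)"
  shows "von_neumann_regular (compact_sections \<G> \<O>) \<longleftrightarrow>
    (\<forall>x\<in>unit_space \<G>. field (stalk \<O> x))"
proof -
  interpret ample_groupoid \<G> by fact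
  interpret gsheaf_of_rings \<G> \<O> by fact
  show ?thesis
  proof
    assume reg: "von_neumann_regular (compact_sections \<G> \<O>)"
    show "\<forall>x\<in>unit_space \<G>. field (stalk \<O> x)"
      using indecomposable_cring_fieldI[OF assms(3,4)]
        von_neumann_regular_stalk[OF unit_Hausdorff unit_compact_open_basis reg] by blast
  next
    assume "\<forall>x\<in>unit_space \<G>. field (stalk \<O> x)"
    then show "von_neumann_regular (compact_sections \<G> \<O>)"
      using von_neumann_regular_compact_sections by blast
  qed
qed

end
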